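(* Let $G$ be an abelian group, $r,\ell\in\mathbb N$, and let $\mathcal A=(A_1,\dots,A_q)$ be a chromatic asymptotic $(r,\ell)$-approximate group in $G$. Let $B\subseteq G$ be a nonempty finite set with $|B|=m$. Then the family $S_{\mathbf h}:=\mathbf h\cdot\mathcal A+B$ ($\mathbf h\in\mathbb N_0^q$) is an asymptotic $\left(r,\ell\binom{(r+1)(m-1)}{m-1}\right)$-approximate family.
   Context: $\mathbb N=\{1,2,\dots\}$, $\mathbb N_0=\{0,1,2,\dots\}$. For subsets $X,Y$, $X+Y=\{x+y:x\in X,y\in Y\}$; for $h\in\mathbb N$, $hA$ is the $h$-fold sumset $A+\cdots+A$ and $0A=\{0\}$. For a tuple $\mathcal A$ of nonempty subsets of $G$ and $\mathbf h=(h_1,\dots,h_q)\in\mathbb N_0^q$, $\mathbf h\cdot\mathcal A=h_1A_1+\cdots+h_qA_q$, $r\mathbf h=(rh_1,\dots,rh_q)$, and $\mathbf h\preceq\mathbf h'$ means $h_i\le h_i'$ for all $i$. $\mathcal A$ is a chromatic asymptotic $(r,\ell)$-approximate group if there is $\mathbf h_0$ such that for every $\mathbf h\succeq\mathbf h_0$ there is $X_{\mathbf h}\subseteq G$ with $|X_{\mathbf h}|\le\ell$ and $(r\mathbf h)\cdot\mathcal A\subseteq X_{\mathbf h}+\mathbf h\cdot\mathcal A$. For nonempty $B\subseteq G$, the family $\mathbf h\cdot\mathcal A+B$ is an asymptotic $(r,L)$-approximate family if there is $\mathbf h_0$ such that for every $\mathbf h\succeq\mathbf h_0$ there is $Y_{\mathbf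 h}\subseteq G$ with $|Y_{\mathbf h}|\le L$ and $r(\mathbf h\cdot\mathcal A+B)\subseteq Y_{\mathbf h}+\mathbf h\cdot\mathcal A+B$. *)

theory Defs
  imports Main "HOL-Library.Set_Algebras"
begin

text \<open>
  Sumsets \<open>X + Y\<close> and \<open>0 = {0}\<close> on sets are those of \<open>Set_Algebras\<close>.
  A \<open>q\<close>-tuple is a function on \<open>nat\<close> of which only the values at \<open>1, \<dots>, q\<close> are used.
\<close>

primrec sumset_fold :: "nat \<Rightarrow> 'a::ab_group_add set \<Rightarrow> 'a set" where
  "sumset_fold 0 A = {0}"
| "sumset_fold (Suc n) A = A + sumset_fold n A"

definition chrom_sumset :: "nat \<Rightarrow> (nat \<Rightarrow> nat) \<Rightarrow> (nat \<Rightarrow> 'a::ab_group_add set) \<Rightarrow> 'a set" where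
  "chrom_sumset q h A = (\<Sum>i\<in>{1..q}. sumset_fold (h i) (A i))"

definition tuple_le :: "nat \<Rightarrow> (nat \<Rightarrow> nat) \<Rightarrow> (nat \<Rightarrow> nat) \<Rightarrow> bool" where
  "tuple_le q h h' \<longleftrightarrow> (\<forall>i\<in>{1..q}. h i \<le> h' i)"

definition chrom_asymptotic_approx_group ::
    "nat \<Rightarrow> nat \<Rightarrow> nat \<Rightarrow> (nat \<Rightarrow> 'a::ab_group_add set) \<Rightarrow> bool" where
  "chrom_asymptotic_approx_group r l q A \<longleftrightarrow>
     (\<forall>i\<in>{1..q}. A i \<noteq> {}) \<and>
     (\<exists>h0. \<forall>h. tuple_le q h0 h \<longrightarrow>
        (\<exists>X. finite X \<and> card X \<le> l \<and>
           chrom_sumset q (\<lambda>i. r * h i) A \<subseteq> X + chrom_sumset q h A))"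

text \<open>
  Below, the multiple of \<open>S h\<close> is its \<open>r\<close>-fold sumset, whereas above the tuple \<open>h\<close> is
  multiplied by \<open>r\<close>.
\<close>

definition asymptotic_approx_family ::
    "nat \<Rightarrow> nat \<Rightarrow> nat \<Rightarrow> ((nat \<Rightarrow> nat) \<Rightarrow> 'a::ab_group_add set) \<Rightarrow> bool" where
  "asymptotic_approx_family r L q S \<longleftrightarrow>
     (\<exists>h0. \<forall>h. tuple_le q h0 h \<longrightarrow>
        (\<exists>Y. finite Y \<and> card Y \<le> L \<and> sumset_fold r (S h) \<subseteq> Y + S h))"

end

theory Submission
  imports Defs
begin

text \<open>
  Since \<open>rB = (r - 1)B + B\<close>, the set \<open>X + (r - 1)B\<close> covers \<open>r(h \<sqdot> A + B)\<close> by translates of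
  \<open>h \<sqdot> A + B\<close> whenever \<open>X\<close> covers \<open>(r h) \<sqdot> A\<close> by translates of \<open>h \<sqdot> A\<close>. An element of
  \<open>(r - 1)B\<close> is determined by a multiset of size \<open>r - 1\<close> over \<open>B\<close>, which leaves at most
  \<open>(r + m - 2) choose (m - 1)\<close> of them.
\<close>

lemma sumset_fold_add: "sumset_fold (m + n) A = sumset_fold m A + sumset_fold n A"
  by (induction m) (simp_all add: add.assoc flip: set_zero)

lemma sumset_fold_plus: "sumset_fold n (A + B) = sumset_fold n A + sumset_fold n B"
  by (induction n) (simp_all add: ac_simps flip: set_zero)

lemma sumset_fold_zero: "sumset_fold n {0} = {0}"
  by (induction n) (simp_all flip: set_zero)

lemma sumset_fold_mult: "sumset_fold n (sumset_fold k A) = sumset_fold (n * k) A"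
  by (induction n) (simp_all add: sumset_fold_add)

lemma sumset_fold_sum:
  "sumset_fold n (\<Sum>i\<in>I. F i) = (\<Sum>i\<in>I. sumset_fold n (F i))"
  by (induction I rule: infinite_finite_induct)
    (simp_all add: sumset_fold_plus sumset_fold_zero)

text \<open>This reconciles the two notions of multiple: the conclusion is about
  \<open>n\<close>-fold sumsets, the hypothesis about scaling the tuple \<open>h\<close>.\<close>

lemma sumset_fold_chrom_sumset:
  "sumset_fold n (chrom_sumset q h A) = chrom_sumset q (\<lambda>i. n * h i) A"
  by (simp add: chrom_sumset_def sumset_fold_sum sumset_fold_mult)

lemma finite_sumset_fold: "finite B \<Longrightarrow> finite (sumset_fold n B)"
  by (induction n) (simp_all add: finite_set_plus)

lemma card_set_plus_le:
  assumes "finite X" "finite Y"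
  shows "card (X + Y) \<le> card X * card Y"
  using card_image_le[of "X \<times> Y" "\<lambda>(x, y). x + y"] assms
  by (simp add: set_plus_image card_cartesian_product)

text \<open>A sum of \<open>Suc n\<close> terms either avoids \<open>b\<close> or has
  \<open>b\<close> as a term, which commutativity moves to the front. This is the set form of
  Pascal's rule.\<close>

lemma sumset_fold_Suc_insert_subset:
  "sumset_fold (Suc n) (insert b B)
     \<subseteq> sumset_fold (Suc n) B \<union> ({b} + sumset_fold n (insert b B))"
proof (induction n)
  case 0
  show ?case by (auto simp: set_plus_def)
next
  case (Suc n)
  show ?case
  proof
    fix z assume "z \<in> sumset_fold (Suc (Suc n)) (insert b B)"
    then obtain x y where z: "z = x + y" and x: "x \<in> insert b B"
      and y: "y \<in> sumset_fold (Suc n) (insert b B)"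
      unfolding sumset_fold.simps(2)[of "Suc n"] by (rule set_plus_elim)
    \<comment> \<open>The induction hypothesis is applied to the tail \<open>y\<close>: if
      \<open>x\<close> is not \<open>b\<close>, then \<open>y\<close> either avoids \<open>b\<close>
      or already yields a copy of it.\<close>
    consider "x = b" | "x \<in> B" "y \<in> sumset_fold (Suc n) B"
      | "y \<in> {b} + sumset_fold n (insert b B)"
      using x y Suc.IH by blast
    then show "z \<in> sumset_fold (Suc (Suc n)) B \<union> ({b} + sumset_fold (Suc n) (insert b B))"
    proof cases
      case 1
      then show ?thesis using z y by blast
    next
      case 2
      then show ?thesis using z by (metis UnI1 set_plus_intro sumset_fold.simps(2))
    next
      case 3
      then obtain w where "y = b + w" "w \<in> sumset_fold n (insert b B)"
        by (auto elim: set_plus_elim)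
      then have "z = b + (x + w)" "x + w \<in> sumset_fold (Suc n) (insert b B)"
        using z x by (auto simp: add.left_commute)
      then show ?thesis by blast
    qed
  qed
qed

text \<open>The bound counts multisets of size \<open>n\<close> over \<open>B\<close>. The proof
  nests an induction on \<open>n\<close> inside one on \<open>B\<close>, following the recursion of
  Pascal's triangle.\<close>

lemma card_sumset_fold_le:
  fixes B :: "'a::ab_group_add set"
  assumes "finite B" "B \<noteq> {}"
  shows "card (sumset_fold n B) \<le> (n + (card B - 1)) choose (card B - 1)"
  using assms
proof (induction B arbitrary: n rule: finite_ne_induct)
  case (singleton b)
  have "card (sumset_fold n {b}) \<le> 1"
  proof (induction n)
    case (Suc n)
    then show ?case
      using card_set_plus_le[of "{b}" "sumset_fold n {b}"] by (simp add: finite_sumset_fold)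
  qed simp
  then show ?case by simp
next
  case (insert b B)
  obtain k where k: "card B = Suc k"
    using insert.hyps by (metis card_0_eq not0_implies_Suc)
  have "card (sumset_fold n (insert b B)) \<le> (n + Suc k) choose Suc k"
  proof (induction n)
    case (Suc n)
    have fin: "finite (sumset_fold j B)" "finite (sumset_fold j (insert b B))" for j
      using insert.hyps by (simp_all add: finite_sumset_fold)
    have "card (sumset_fold (Suc n) (insert b B))
        \<le> card (sumset_fold (Suc n) B \<union> ({b} + sumset_fold n (insert b B)))"
      by (intro card_mono sumset_fold_Suc_insert_subset finite_UnI finite_set_plus fin) simp
    also have "\<dots> \<le> card (sumset_fold (Suc n) B) + card ({b} + sumset_fold n (insert b B))"
      by (rule card_Un_le)
    \<comment> \<open>The outer hypothesis, for \<open>B\<close> at \<open>Suc n\<close>, bounds the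
      sums without \<open>b\<close>; the inner one bounds the others, since translation by
      \<open>b\<close> adds no elements.\<close>
    also have "\<dots> \<le> ((Suc n + k) choose k) + ((n + Suc k) choose Suc k)"
      using insert.IH[of "Suc n"] card_set_plus_le[of "{b}" "sumset_fold n (insert b B)"]
        fin Suc.IH k
      by (intro add_mono) auto
    also have "\<dots> = (Suc n + Suc k) choose Suc k"
      by simp
    finally show ?case .
  qed simp
  then show ?case using insert.hyps k by simp
qed

theorem theorem1p16:
  fixes A :: "nat \<Rightarrow> 'a::ab_group_add set" and B :: "'a set"
    and q r l m :: nat
  assumes "q \<ge> 1" and "r \<ge> 1" and "l \<ge> 1"
    and "chrom_asymptotic_approx_group r l q A"
    and "finite B" and "B \<noteq> {}" and "card B = m"
  shows "asymptotic_approx_family r (l * (((r + 1) * (m - 1)) choose (m - 1))) q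
           (\<lambda>h. chrom_sumset q h A + B)"
proof -
  \<comment> \<open>Of the \<open>r\<close> copies of \<open>B\<close>, \<open>s\<close> go into the
    translating set and one remains in the translated set.\<close>
  obtain s where r: "r = Suc s"
    using \<open>r \<ge> 1\<close> by (cases r) auto
  obtain h0 where h0: "\<And>h. tuple_le q h0 h \<Longrightarrow> \<exists>X. finite X \<and> card X \<le> l \<and>
      chrom_sumset q (\<lambda>i. r * h i) A \<subseteq> X + chrom_sumset q h A"
    using assms(4) unfolding chrom_asymptotic_approx_group_def by blast
  \<comment> \<open>For \<open>m = 1\<close> the right side is 0 and the inequality can fail, but
    then both binomial coefficients below equal 1.\<close>
  have "s + (m - 1) \<le> (r + 1) * (m - 1)" if "m - 1 \<noteq> 0"
    using that by (cases "m - 1") (simp_all add: r)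
  then have "(s + (m - 1)) choose (m - 1) \<le> ((r + 1) * (m - 1)) choose (m - 1)"
    by (cases "m - 1 = 0") (auto intro: binomial_right_mono)
  then have cardB: "card (sumset_fold s B) \<le> ((r + 1) * (m - 1)) choose (m - 1)"
    using card_sumset_fold_le[of B s] assms(5-7) by simp
  have "\<exists>Y. finite Y \<and> card Y \<le> l * (((r + 1) * (m - 1)) choose (m - 1)) \<and>
      sumset_fold r (chrom_sumset q h A + B) \<subseteq> Y + (chrom_sumset q h A + B)"
    if h: "tuple_le q h0 h" for h
  proof -
    obtain X where X: "finite X" "card X \<le> l"
      "chrom_sumset q (\<lambda>i. r * h i) A \<subseteq> X + chrom_sumset q h A"
      using h0[OF h] by blast
    let ?Y = "X + sumset_fold s B"
    have fin: "finite (sumset_fold s B)"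
      using assms(5) by (rule finite_sumset_fold)
    have "sumset_fold r (chrom_sumset q h A + B)
        = chrom_sumset q (\<lambda>i. r * h i) A + sumset_fold r B"
      by (simp only: sumset_fold_plus sumset_fold_chrom_sumset)
    also have "\<dots> \<subseteq> X + chrom_sumset q h A + sumset_fold r B"
      by (intro set_plus_mono2 X order_refl)
    also have "\<dots> = ?Y + (chrom_sumset q h A + B)"
      by (simp add: r ac_simps)
    finally have "sumset_fold r (chrom_sumset q h A + B) \<subseteq> ?Y + (chrom_sumset q h A + B)" .
    moreover have "card ?Y \<le> l * (((r + 1) * (m - 1)) choose (m - 1))"
      using card_set_plus_le[OF X(1) fin] mult_le_mono[OF X(2) cardB] by (rule order_trans)
    moreover have "finite ?Y"
      using X(1) fin by (rule finite_set_plus)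
    ultimately show ?thesis by blast
  qed
  then show ?thesis
    unfolding asymptotic_approx_family_def by blast
qed

end
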